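(* Let $J$ be a conjugation on a complex Hilbert space $H$. Then the following assertions hold: 1) If $A$ is a (possibly unbounded) $J$-unitary operator in $H$, then $$A = UB,$$ where $U$ is a unitary $J$-real operator on $H$, and $B$ is a non-negative self-adjoint $J$-unitary operator in $H$. 2) If a linear operator $A$ in $H$ admits a representation $A = UB$ with a unitary $J$-real operator $U$ on $H$ and a non-negative self-adjoint $J$-unitary operator $B$ in $H$, then $A$ is $J$-unitary.
   Context: Linear operators $A$ in a Hilbert space $H$ are defined on a linear subspace $D(A)\subseteq H$ (the domain) and may be unbounded. Equalities of operators include equality of domains, and products carry their natural domains. $A^*$ denotes the adjoint of a densely defined $A$; $A^{-1}$ denotes the inverse of an injective $A$, defined on the range $R(A)$. A conjugation $J$ on $H$ is an antilinear operator on $H$ (defined on all of $H$) such that $J^2x=x$ for all $x\in H$ and $(Jx,Jy)_H=(y,x)_H$ for all $x,y\in H$. A linear operator $A$ in $H$ is called $J$-unitary if $A^{-1}=JA^*J$ (this entails that $A$ is densely defined and injective, so that $A^*$ and $A^{-1}$ exist; $A$ is not assumed bounded). A linear operator $A$ in $H$ is called $J$-real if $f\in D(A)$ implies $Jf\in D(A)$ and $AJf=JAf$. *)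

theory Defs
  imports "HOL-Analysis.Analysis"
begin

(* The underlying real structure is the one of real_inner (with inner = Re cinner), so that norm,
   metric and topology are those of the library; the inner product is linear in its first argument. *)
class complex_inner = real_inner +
  fixes scaleC :: "complex \<Rightarrow> 'a \<Rightarrow> 'a" (infixr "*\<^sub>C" 75)
    and cinner :: "'a \<Rightarrow> 'a \<Rightarrow> complex"
  assumes scaleC_add_right: "a *\<^sub>C (x + y) = a *\<^sub>C x + a *\<^sub>C y"
    and scaleC_add_left: "(a + b) *\<^sub>C x = a *\<^sub>C x + b *\<^sub>C x"
    and scaleC_scaleC: "a *\<^sub>C (b *\<^sub>C x) = (a * b) *\<^sub>C x"
    and scaleC_of_real: "complex_of_real r *\<^sub>C x = r *\<^sub>R x"
    and cinner_commute: "cinner x y = cnj (cinner y x)"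
    and cinner_add_left: "cinner (x + y) z = cinner x z + cinner y z"
    and cinner_scaleC_left: "cinner (a *\<^sub>C x) y = a * cinner x y"
    and Re_cinner: "Re (cinner x y) = inner x y"

class complex_hilbert = complex_inner + complete_space

lemma scaleC_one: "1 *\<^sub>C x = (x :: 'a :: complex_inner)"
  using scaleC_of_real[of 1 x] by simp

lemma cinner_self: "cinner x x = complex_of_real ((norm x)\<^sup>2)" for x :: "'a :: complex_inner"
proof (rule complex_eqI)
  show "Re (cinner x x) = Re (complex_of_real ((norm x)\<^sup>2))"
    by (simp add: Re_cinner power2_norm_eq_inner)
  have "Im (cinner x x) = Im (cnj (cinner x x))"
    using cinner_commute[of x x] by (rule arg_cong)
  then show "Im (cinner x x) = Im (complex_of_real ((norm x)\<^sup>2))"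
    by simp
qed

instantiation complex :: complex_hilbert
begin

definition scaleC_complex :: "complex \<Rightarrow> complex \<Rightarrow> complex" where
  "scaleC_complex a x = a * x"

definition cinner_complex :: "complex \<Rightarrow> complex \<Rightarrow> complex" where
  "cinner_complex x y = x * cnj y"

instance
  by standard
    (simp_all add: scaleC_complex_def cinner_complex_def inner_complex_def algebra_simps
      scaleR_conv_of_real)

end

(* An operator A in H is a partial function: D(A) is "dom A", R(A) is "ran A", the product AB with
   its natural domain is "A \<circ>\<^sub>m B", and equality of partial functions includes equality of domains. *)
type_synonym 'a operator = "'a \<rightharpoonup> 'a"

definition linear_op :: "'a :: complex_inner operator \<Rightarrow> bool" where
  "linear_op A \<longleftrightarrow>
     0 \<in> dom A \<and>
     (\<forall>x\<in>dom A. \<forall>y\<in>dom A. x + y \<in> dom A \<and> the (A (x + y)) = the (A x) + the (A y)) \<and>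
     (\<forall>c. \<forall>x\<in>dom A. c *\<^sub>C x \<in> dom A \<and> the (A (c *\<^sub>C x)) = c *\<^sub>C the (A x))"

definition densely_defined :: "'a :: complex_inner operator \<Rightarrow> bool" where
  "densely_defined A \<longleftrightarrow> closure (dom A) = UNIV"

definition injective_op :: "'a operator \<Rightarrow> bool" where
  "injective_op A \<longleftrightarrow> inj_on A (dom A)"

(* Meaningful for densely defined A only: then the vector z is unique. *)
definition adjoint_op :: "'a :: complex_inner operator \<Rightarrow> 'a operator" where
  "adjoint_op A = (\<lambda>y.
     if \<exists>z. \<forall>x\<in>dom A. cinner (the (A x)) y = cinner x z
     then Some (THE z. \<forall>x\<in>dom A. cinner (the (A x)) y = cinner x z)
     else None)"

(* Meaningful for injective A only. *)
definition inverse_op :: "'a operator \<Rightarrow> 'a operator" where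
  "inverse_op A = (\<lambda>y. if y \<in> ran A then Some (THE x. A x = Some y) else None)"

definition conjugation :: "('a :: complex_inner \<Rightarrow> 'a) \<Rightarrow> bool" where
  "conjugation J \<longleftrightarrow>
     (\<forall>x y. J (x + y) = J x + J y) \<and>
     (\<forall>c x. J (c *\<^sub>C x) = cnj c *\<^sub>C J x) \<and>
     (\<forall>x. J (J x) = x) \<and>
     (\<forall>x y. cinner (J x) (J y) = cinner y x)"

(* "Some \<circ> J" is J regarded as an everywhere defined operator. *)
definition J_unitary :: "('a :: complex_inner \<Rightarrow> 'a) \<Rightarrow> 'a operator \<Rightarrow> bool" where
  "J_unitary J A \<longleftrightarrow>
     linear_op A \<and> densely_defined A \<and> injective_op A \<and>
     inverse_op A = (Some \<circ> J) \<circ>\<^sub>m adjoint_op A \<circ>\<^sub>m (Some \<circ> J)"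

definition J_real :: "('a :: complex_inner \<Rightarrow> 'a) \<Rightarrow> 'a operator \<Rightarrow> bool" where
  "J_real J A \<longleftrightarrow>
     linear_op A \<and> (\<forall>f\<in>dom A. J f \<in> dom A \<and> the (A (J f)) = J (the (A f)))"

definition unitary_op :: "'a :: complex_inner operator \<Rightarrow> bool" where
  "unitary_op U \<longleftrightarrow>
     linear_op U \<and> dom U = UNIV \<and> ran U = UNIV \<and>
     (\<forall>x y. cinner (the (U x)) (the (U y)) = cinner x y)"

definition self_adjoint_op :: "'a :: complex_inner operator \<Rightarrow> bool" where
  "self_adjoint_op B \<longleftrightarrow> linear_op B \<and> densely_defined B \<and> adjoint_op B = B"

definition nonneg_op :: "'a :: complex_inner operator \<Rightarrow> bool" where
  "nonneg_op B \<longleftrightarrow> linear_op B \<and> (\<forall>x\<in>dom B. cinner (the (B x)) x \<in> \<real>\<^sub>\<ge>\<^sub>0)"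

end

theory Submission
  imports Defs
begin

text \<open>
  A \<open>J\<close>-unitary \<open>A\<close> is closed, and \<open>A\<^sup>-\<^sup>1 = J A\<^sup>* J\<close> says that \<open>J\<close> conjugates \<open>T = A\<^sup>*A\<close> into its inverse.
  For the resolvent \<open>S = (I + T)\<^sup>-\<^sup>1\<close> this reads \<open>J S J = I - S\<close>, so with \<open>R = S\<^bsup>1/2\<^esup>\<close> the bounded
  operator \<open>C = J R J\<close> is the root of \<open>I - S\<close>, commutes with \<open>R\<close>, and \<open>R\<^sup>2 + C\<^sup>2 = I\<close>.  Hence the
  modulus of \<open>A\<close> is \<open>B = C R\<^sup>-\<^sup>1\<close>, whose self-adjointness and \<open>J\<close>-unitarity are immediate from the
  description \<open>{(y, z). R z = C y}\<close> of its graph, and the unitary factor is determined by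
  \<open>U C = A R\<close>.  No spectral theorem is needed: \<open>S\<close> comes from the projection onto the graph of \<open>A\<close>,
  and the bounded root from a norm convergent iteration.  Real parts of inner products suffice
  almost everywhere, since all the operators are complex linear.
\<close>

section \<open>Projections and square roots in real Hilbert spaces\<close>

lemma norm_add_sq: "(norm (x + y))\<^sup>2 = (norm x)\<^sup>2 + 2 * inner x y + (norm y)\<^sup>2"
  for x y :: "'a :: real_inner"
  by (simp add: power2_norm_eq_inner algebra_simps inner_commute)

text \<open>A minimizing sequence is Cauchy by the parallelogram law, since midpoints stay in
  \<open>S\<close>. The lemma is applied to closures, to the graph of \<open>A\<close> and to the
  range of \<open>U\<close>.\<close>

lemma ex_orthogonal_projection:
  fixes S :: "'a :: real_inner set"
  assumes S: "subspace S" and "complete S"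
  shows "\<exists>u\<in>S. \<forall>v\<in>S. inner (x - u) v = 0"
proof -
  define d where "d = infdist x S"
  have "S \<noteq> {}"
    using subspace_0[OF S] by blast
  have d0: "0 \<le> d"
    unfolding d_def by (rule infdist_nonneg)
  have d: "d\<^sup>2 \<le> (norm (x - v))\<^sup>2" if "v \<in> S" for v
    using infdist_le[OF that, of x] d0 by (intro power_mono) (auto simp: d_def dist_norm)
  have "\<exists>u\<in>S. (norm (x - u))\<^sup>2 < d\<^sup>2 + e" if "e > 0" for e
  proof -
    have "d < sqrt (d\<^sup>2 + e)"
      using that d0 by (intro real_less_rsqrt) auto
    then obtain u where u: "u \<in> S" "norm (x - u) < sqrt (d\<^sup>2 + e)"
      using cInf_lessD[of "dist x ` S"] \<open>S \<noteq> {}\<close>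
      by (auto simp: d_def infdist_notempty dist_norm)
    have "(norm (x - u))\<^sup>2 < (sqrt (d\<^sup>2 + e))\<^sup>2"
      using u by (intro power_strict_mono) auto
    with u that show ?thesis
      by (auto simp: add_nonneg_nonneg)
  qed
  then have "\<exists>u. u \<in> S \<and> (norm (x - u))\<^sup>2 < d\<^sup>2 + inverse (real (Suc n))" for n
    by (metis inverse_positive_iff_positive of_nat_0_less_iff zero_less_Suc)
  then obtain u where uS: "\<And>n. u n \<in> S"
    and u: "\<And>n. (norm (x - u n))\<^sup>2 < d\<^sup>2 + inverse (real (Suc n))"
    by metis
  have bound: "(norm (u m - u n))\<^sup>2 \<le> 2 * inverse (real (Suc m)) + 2 * inverse (real (Suc n))"
    for m n
  proof -
    have "(1/2) *\<^sub>R (u m + u n) \<in> S"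
      using S uS by (intro subspace_mul subspace_add)
    note mid = d[OF this]
    have "(x - u m) + (x - u n) = 2 *\<^sub>R (x - (1/2) *\<^sub>R (u m + u n))"
      by (simp add: algebra_simps scaleR_2)
    then have "(norm ((x - u m) + (x - u n)))\<^sup>2 = 4 * (norm (x - (1/2) *\<^sub>R (u m + u n)))\<^sup>2"
      by (simp only: norm_scaleR power_mult_distrib) simp
    with mid have "4 * d\<^sup>2 \<le> (norm ((x - u m) + (x - u n)))\<^sup>2"
      by simp
    moreover have "(norm (u m - u n))\<^sup>2 + (norm ((x - u m) + (x - u n)))\<^sup>2
        = 2 * (norm (x - u m))\<^sup>2 + 2 * (norm (x - u n))\<^sup>2"
      by (simp add: power2_norm_eq_inner algebra_simps inner_commute)
    ultimately show ?thesis
      using u[of m] u[of n] by linarith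
  qed
  have "Cauchy u"
  proof (rule metric_CauchyI)
    fix e :: real
    assume "e > 0"
    then obtain N where N: "inverse (real (Suc N)) < e\<^sup>2 / 4"
      using reals_Archimedean[of "e\<^sup>2 / 4"] by auto
    have "dist (u m) (u n) < e" if "m \<ge> N" "n \<ge> N" for m n
    proof -
      have "inverse (real (Suc m)) \<le> inverse (real (Suc N))"
        "inverse (real (Suc n)) \<le> inverse (real (Suc N))"
        using that by (auto intro!: le_imp_inverse_le)
      with bound[of m n] N have "(norm (u m - u n))\<^sup>2 < e\<^sup>2"
        by linarith
      then show ?thesis
        using \<open>e > 0\<close> by (simp add: dist_norm power2_less_imp_less)
    qed
    then show "\<exists>M. \<forall>m\<ge>M. \<forall>n\<ge>M. dist (u m) (u n) < e"
      by blast
  qed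
  then obtain l where l: "l \<in> S" "u \<longlonglongrightarrow> l"
    using \<open>complete S\<close> uS unfolding complete_def by blast
  have "(\<lambda>n. (norm (x - u n))\<^sup>2) \<longlonglongrightarrow> (norm (x - l))\<^sup>2"
    by (intro tendsto_intros l)
  moreover have "(\<lambda>n. d\<^sup>2 + inverse (real (Suc n))) \<longlonglongrightarrow> d\<^sup>2 + 0"
    by (intro tendsto_intros LIMSEQ_inverse_real_of_nat)
  ultimately have min: "(norm (x - l))\<^sup>2 \<le> d\<^sup>2"
    using u by (intro LIMSEQ_le) (auto intro: less_imp_le)
  have "inner (x - l) v = 0" if v: "v \<in> S" for v
  proof (cases "v = 0")
    case False
    \<comment> \<open>The step along \<open>v\<close> that minimizes the distance to
      \<open>x\<close> on the line through \<open>l\<close>.\<close>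
    define t where "t = inner (x - l) v / inner v v"
    have "l + t *\<^sub>R v \<in> S"
      using S l v by (intro subspace_add subspace_mul)
    moreover have "x - (l + t *\<^sub>R v) = (x - l) + (- t) *\<^sub>R v"
      by simp
    ultimately have "(norm (x - l))\<^sup>2 \<le> (norm ((x - l) + (- t) *\<^sub>R v))\<^sup>2"
      using d min by (metis order_trans)
    then have "2 * t * inner (x - l) v \<le> t\<^sup>2 * inner v v"
      by (simp only: norm_add_sq)
        (simp add: power_mult_distrib power2_norm_eq_inner)
    also have "\<dots> = t * inner (x - l) v"
      using False by (simp add: t_def power2_eq_square)
    finally have "t * inner (x - l) v \<le> 0"
      by simp
    then have "(inner (x - l) v)\<^sup>2 \<le> 0"
      using False inner_gt_zero_iff[of v]
      by (auto simp: t_def power2_eq_square divide_le_0_iff simp del: inner_gt_zero_iff)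
    then show ?thesis
      by simp
  qed simp
  with l show ?thesis
    by blast
qed

lemma subspace_closure:
  fixes S :: "'a :: real_normed_vector set"
  assumes S: "subspace S"
  shows "subspace (closure S)"
proof (rule subspaceI)
  show "0 \<in> closure S"
    using subspace_0[OF S] closure_subset by blast
next
  fix x y
  assume "x \<in> closure S" "y \<in> closure S"
  then obtain f g where "\<And>n. f n \<in> S" "f \<longlonglongrightarrow> x" "\<And>n. g n \<in> S" "g \<longlonglongrightarrow> y"
    unfolding closure_sequential by blast
  then have "(\<forall>n. f n + g n \<in> S) \<and> (\<lambda>n. f n + g n) \<longlonglongrightarrow> x + y"
    by (auto intro: subspace_add[OF S] tendsto_add)
  then show "x + y \<in> closure S"
    unfolding closure_sequential by (intro exI[of _ "\<lambda>n. f n + g n"])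
next
  fix c and x
  assume "x \<in> closure S"
  then obtain f where "\<And>n. f n \<in> S" "f \<longlonglongrightarrow> x"
    unfolding closure_sequential by blast
  then have "(\<forall>n. c *\<^sub>R f n \<in> S) \<and> (\<lambda>n. c *\<^sub>R f n) \<longlonglongrightarrow> c *\<^sub>R x"
    by (auto intro: subspace_scale[OF S] tendsto_scaleR)
  then show "c *\<^sub>R x \<in> closure S"
    unfolding closure_sequential by (intro exI[of _ "\<lambda>n. c *\<^sub>R f n"])
qed

text \<open>The residual of the projection onto \<open>closure S\<close> is orthogonal to
  \<open>S\<close>, hence zero.\<close>

lemma closure_eq_UNIV_if_orthogonal_trivial:
  fixes S :: "'a :: {real_inner, banach} set"
  assumes "subspace S" and orth: "\<And>x. (\<And>v. v \<in> S \<Longrightarrow> inner x v = 0) \<Longrightarrow> x = 0"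
  shows "closure S = UNIV"
proof -
  have "subspace (closure S)" "complete (closure S)"
    using assms(1) by (simp_all add: subspace_closure complete_eq_closed)
  have "x \<in> closure S" for x
  proof -
    obtain u where u: "u \<in> closure S" "\<And>v. v \<in> closure S \<Longrightarrow> inner (x - u) v = 0"
      using ex_orthogonal_projection[OF \<open>subspace (closure S)\<close> \<open>complete (closure S)\<close>] by metis
    then have "x - u = 0"
      using closure_subset by (intro orth) blast
    with u show ?thesis
      by simp
  qed
  then show ?thesis
    by blast
qed

lemma orthogonal_to_dense_eq_0:
  assumes "closure S = UNIV" "\<And>v. v \<in> S \<Longrightarrow> inner x v = 0"
  shows "x = 0"
proof -
  have "closure S \<subseteq> {v. inner x v = 0}"
    using assms(2) by (intro closure_minimal closed_Collect_eq continuous_intros) auto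
  with assms(1) have "inner x x = 0"
    by blast
  then show ?thesis
    by simp
qed

text \<open>The iteration \<open>X\<^sub>n\<^sub>+\<^sub>1 = (T + X\<^sub>n\<^sup>2) / 2\<close> with \<open>T = I - S\<close> converges to \<open>I - R\<close>; it is Cauchy in norm
  because its increments are dominated by those of the same iteration for the number \<open>1\<close>.\<close>

lemma ex_sqrt_contraction:
  fixes S :: "'a :: {real_inner, banach} \<Rightarrow> 'a"
  assumes "bounded_linear S" and sym: "\<And>x y. inner (S x) y = inner x (S y)"
    and contr: "\<And>x. norm (x - S x) \<le> norm x"
  shows "\<exists>R. bounded_linear R \<and> (\<forall>x y. inner (R x) y = inner x (R y)) \<and>
    (\<forall>x. norm (x - R x) \<le> norm x) \<and> (\<forall>x. R (R x) = S x) \<and>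
    (\<forall>K. bounded_linear K \<longrightarrow> (\<forall>x. K (S x) = S (K x)) \<longrightarrow> (\<forall>x. K (R x) = R (K x)))"
proof -
  define T where "T = Blinfun (\<lambda>x. x - S x)"
  have T: "blinfun_apply T x = x - S x" for x
    unfolding T_def
    by (simp add: bounded_linear_Blinfun_apply bounded_linear_sub bounded_linear_ident \<open>bounded_linear S\<close>)
  have normT: "norm T \<le> 1"
    by (rule norm_blinfun_bound) (simp_all add: T contr)
  define X where "X = rec_nat 0 (\<lambda>_ Y. (1/2) *\<^sub>R (T + (Y o\<^sub>L Y)))"
  define t where "t = rec_nat 0 (\<lambda>_ s. (1 + s\<^sup>2) / 2 :: real)"
  have X0: "X 0 = 0" and XS: "X (Suc n) = (1/2) *\<^sub>R (T + (X n o\<^sub>L X n))" for n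
    by (simp_all add: X_def)
  have t0: "t 0 = 0" and tS: "t (Suc n) = (1 + (t n)\<^sup>2) / 2" for n
    by (simp_all add: t_def)
  have t_bounds: "0 \<le> t n \<and> t n \<le> 1" for n
    by (induction n) (auto simp: t0 tS power_le_one)
  have t_mono: "t n \<le> t (Suc n)" for n
    using zero_le_power2[of "t n - 1"] by (simp add: tS power2_eq_square algebra_simps)
  have normX: "norm (X n) \<le> t n" for n
  proof (induction n)
    case (Suc n)
    have "norm (X (Suc n)) \<le> (norm T + norm (X n o\<^sub>L X n)) / 2"
      using norm_triangle_ineq[of T "X n o\<^sub>L X n"] by (simp add: XS)
    also have "\<dots> \<le> (1 + t n * t n) / 2"
      using norm_blinfun_compose[of "X n" "X n"] normT mult_mono[OF Suc Suc] t_bounds[of n]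
      by simp
    finally show ?case
      by (simp add: tS power2_eq_square)
  qed (simp add: X0 t0)
  \<comment> \<open>Every iterate is a polynomial in \<open>S\<close>. Taking \<open>K\<close> to be
    \<open>S\<close> and then an iterate shows that the iterates commute; a general \<open>K\<close>
    is passed to the limit at the end.\<close>
  have K_comm: "K (X n x) = X n (K x)"
    if "bounded_linear K" "\<And>x. K (S x) = S (K x)" for K n x
  proof -
    interpret K: bounded_linear K by fact
    show ?thesis
      by (induction n arbitrary: x)
        (simp_all add: X0 XS T that K.zero K.add K.diff K.scale blinfun.bilinear_simps)
  qed
  have S_X: "S (X n x) = X n (S x)" for n x
    by (rule K_comm) (use \<open>bounded_linear S\<close> in auto)
  have X_T: "X n (T x) = T (X n x)" for n x
    by (simp add: T S_X blinfun.bilinear_simps)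
  have X_X: "X m (X n x) = X n (X m x)" for m n x
    by (rule K_comm) (auto simp: S_X blinfun.bounded_linear_right)
  have X_diff: "norm (X (Suc n) - X n) \<le> t (Suc n) - t n" for n
  proof (induction n)
    case 0
    show ?case
      using normT by (simp add: X0 XS t0 tS)
  next
    case (Suc n)
    \<comment> \<open>Half the difference of two squares, which factors because the iterates
      commute.\<close>
    have "X (Suc (Suc n)) - X (Suc n)
        = (1/2) *\<^sub>R ((X (Suc n) - X n) o\<^sub>L (X (Suc n) + X n))"
      by (rule blinfun_eqI)
        (simp add: XS X_T X_X blinfun.bilinear_simps algebra_simps)
    also have "norm \<dots> \<le> norm (X (Suc n) - X n) * norm (X (Suc n) + X n) / 2"
      using norm_blinfun_compose by simp
    also have "\<dots> \<le> (t (Suc n) - t n) * (t (Suc n) + t n) / 2"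
      using Suc norm_triangle_ineq[of "X (Suc n)" "X n"] normX[of n] normX[of "Suc n"]
        t_bounds[of n] t_bounds[of "Suc n"] t_mono[of n]
      by (intro divide_right_mono mult_mono) auto
    also have "\<dots> = t (Suc (Suc n)) - t (Suc n)"
      by (simp add: tS[of "Suc n"] tS[of n] power2_eq_square field_simps)
    finally show ?case .
  qed
  have X_diff': "norm (X (n + k) - X n) \<le> t (n + k) - t n" for n k
  proof (induction k)
    case (Suc k)
    have "norm (X (n + Suc k) - X n) \<le> norm (X (Suc (n + k)) - X (n + k)) + norm (X (n + k) - X n)"
      using norm_triangle_ineq[of "X (Suc (n + k)) - X (n + k)" "X (n + k) - X n"] by simp
    with Suc X_diff[of "n + k"] show ?case
      by simp
  qed simp
  have "incseq t"
    using t_mono by (rule incseq_SucI)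
  then have "Cauchy t"
    using t_bounds by (metis LIMSEQ_imp_Cauchy incseq_convergent)
  have "Cauchy X"
  proof (rule CauchyI)
    fix e :: real
    assume "e > 0"
    with \<open>Cauchy t\<close> obtain M where M: "\<And>m n. m \<ge> M \<Longrightarrow> n \<ge> M \<Longrightarrow> norm (t m - t n) < e"
      using CauchyD by blast
    have *: "norm (X n - X m) < e" if "m \<ge> M" "n \<ge> m" for m n
      using X_diff'[of m "n - m"] M[of n m] that by auto
    have "norm (X m - X n) < e" if "m \<ge> M" "n \<ge> M" for m n
      using *[of m n] *[of n m] that by (metis nle_le norm_minus_commute)
    then show "\<exists>M. \<forall>m\<ge>M. \<forall>n\<ge>M. norm (X m - X n) < e"
      by blast
  qed
  then obtain L where L: "X \<longlonglongrightarrow> L"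
    using Cauchy_convergent convergent_def by blast
  have Lx: "(\<lambda>n. X n x) \<longlonglongrightarrow> L x" for x
    by (intro tendsto_intros L)
  have "(\<lambda>n. X (Suc n)) \<longlonglongrightarrow> (1/2) *\<^sub>R (T + (L o\<^sub>L L))"
    unfolding XS by (intro tendsto_intros L bounded_bilinear.tendsto[OF bounded_bilinear_blinfun_compose])
  with L have L_eq: "L = (1/2) *\<^sub>R (T + (L o\<^sub>L L))"
    using LIMSEQ_Suc LIMSEQ_unique by blast
  have "norm L \<le> 1"
    using normX t_bounds by (intro LIMSEQ_le_const2[OF tendsto_norm[OF L]]) (meson order_trans)
  have X_sym: "inner (X n x) y = inner x (X n y)" for n x y
    by (induction n arbitrary: x y)
      (simp_all add: X0 XS T sym blinfun.bilinear_simps inner_simps)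
  have L_sym: "inner (L x) y = inner x (L y)" for x y
  proof (rule LIMSEQ_unique)
    show "(\<lambda>n. inner (X n x) y) \<longlonglongrightarrow> inner (L x) y"
      by (intro tendsto_intros Lx)
    show "(\<lambda>n. inner (X n x) y) \<longlonglongrightarrow> inner x (L y)"
      unfolding X_sym by (intro tendsto_intros Lx)
  qed
  show ?thesis
  proof (intro exI[of _ "\<lambda>x. x - L x"] conjI allI impI)
    show "bounded_linear (\<lambda>x. x - L x)"
      by (intro bounded_linear_sub bounded_linear_ident blinfun.bounded_linear_right)
    show "inner (x - L x) y = inner x (y - L y)" for x y
      by (simp add: inner_simps L_sym)
    show "norm (x - (x - L x)) \<le> norm x" for x
      using norm_blinfun[of L x] \<open>norm L \<le> 1\<close> mult_right_mono[of "norm L" 1 "norm x"] by simp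
    \<comment> \<open>The fixed point equation \<open>L = (T + L^2) / 2\<close> rearranges to
      \<open>(I - L)^2 = I - T\<close>, and \<open>I - T = S\<close>.\<close>
    show "x - L x - L (x - L x) = S x" for x
    proof -
      have "L x = (1/2) *\<^sub>R (x - S x + L (L x))"
        by (subst L_eq) (simp add: T blinfun.bilinear_simps)
      then have "2 *\<^sub>R L x = 2 *\<^sub>R (1/2) *\<^sub>R (x - S x + L (L x))"
        by (rule arg_cong)
      then show ?thesis
        by (simp add: blinfun.bilinear_simps scaleR_2 algebra_simps)
    qed
    show "K (x - L x) = K x - L (K x)"
      if "bounded_linear K" and KS: "\<forall>x. K (S x) = S (K x)" for K x
    proof -
      interpret K: bounded_linear K by fact
      note K = \<open>bounded_linear K\<close> KS[rule_format]
      have "K (L x) = L (K x)"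
      proof (rule LIMSEQ_unique)
        show "(\<lambda>n. K (X n x)) \<longlonglongrightarrow> K (L x)"
          by (intro K.tendsto Lx)
        show "(\<lambda>n. K (X n x)) \<longlonglongrightarrow> L (K x)"
          unfolding K_comm[OF K] by (rule Lx)
      qed
      then show ?thesis
        by (simp add: K.diff)
    qed
  qed
qed

section \<open>Complex inner products and partial operators\<close>

instance complex_hilbert \<subseteq> banach ..

lemma scaleC_Re_Im: "c *\<^sub>C x = Re c *\<^sub>R x + Im c *\<^sub>R (\<i> *\<^sub>C x)" for x :: "'a :: complex_inner"
  by (metis complex_eq scaleC_add_left scaleC_of_real scaleC_scaleC mult.commute)

lemma cinner_scaleC_right: "cinner x (c *\<^sub>C y) = cnj c * cinner x y" for x :: "'a :: complex_inner"
  by (metis cinner_commute cinner_scaleC_left complex_cnj_mult)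

lemma Im_cinner: "Im (cinner x y) = inner x (\<i> *\<^sub>C y)" for x :: "'a :: complex_inner"
  by (simp add: Re_cinner[symmetric] cinner_scaleC_right)

lemma inner_scaleC_i: "inner (\<i> *\<^sub>C x) (\<i> *\<^sub>C y) = inner x y" for x :: "'a :: complex_inner"
  by (simp add: Re_cinner[symmetric] cinner_scaleC_right cinner_scaleC_left)

lemma inner_scaleC_i_left: "inner (\<i> *\<^sub>C x) y = - inner x (\<i> *\<^sub>C y)" for x :: "'a :: complex_inner"
  by (simp add: Re_cinner[symmetric] cinner_scaleC_right cinner_scaleC_left)

lemma bounded_linear_scaleC_i: "bounded_linear ((*\<^sub>C) \<i> :: 'a :: complex_inner \<Rightarrow> 'a)"
proof (rule bounded_linear_intro[where K = 1])
  fix r :: real and x :: 'a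
  show "\<i> *\<^sub>C r *\<^sub>R x = r *\<^sub>R \<i> *\<^sub>C x"
    by (metis scaleC_of_real scaleC_scaleC mult.commute)
  show "norm (\<i> *\<^sub>C x) \<le> norm x * 1"
    by (simp add: norm_eq_sqrt_inner inner_scaleC_i)
qed (rule scaleC_add_right)

lemma cinner_eq_iff_inner:
  "cinner x y = cinner z w \<longleftrightarrow> inner x y = inner z w \<and> inner x (\<i> *\<^sub>C y) = inner z (\<i> *\<^sub>C w)"
  for x y z w :: "'a :: complex_inner"
  by (simp add: complex_eq_iff Re_cinner Im_cinner)

text \<open>By complex linearity, the real identity at \<open>\<i> *\<^sub>C x\<close> supplies the
  imaginary part at \<open>x\<close>. Density makes \<open>z\<close> unique, which justifies the
  \<open>THE\<close>.\<close>

lemma adjoint_op_eq_Some_iff: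
  fixes A :: "'a :: complex_inner operator"
  assumes A: "linear_op A" and dense: "densely_defined A"
  shows "adjoint_op A y = Some z \<longleftrightarrow> (\<forall>x\<in>dom A. inner (the (A x)) y = inner x z)"
proof -
  have *: "(\<forall>x\<in>dom A. cinner (the (A x)) y = cinner x z) \<longleftrightarrow> (\<forall>x\<in>dom A. inner (the (A x)) y = inner x z)"
    (is "?L \<longleftrightarrow> ?R") for y z
  proof
    assume R: ?R
    show ?L
    proof
      fix x
      assume x: "x \<in> dom A"
      have ix: "\<i> *\<^sub>C x \<in> dom A" "the (A (\<i> *\<^sub>C x)) = \<i> *\<^sub>C the (A x)"
        using A x unfolding linear_op_def by blast+
      from R x have "inner (the (A x)) y = inner x z"
        by blast
      moreover from R ix have "inner (\<i> *\<^sub>C the (A x)) y = inner (\<i> *\<^sub>C x) z"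
        by metis
      ultimately show "cinner (the (A x)) y = cinner x z"
        by (simp add: cinner_eq_iff_inner inner_scaleC_i_left)
    qed
  qed (metis Re_cinner)
  define P where "P z \<longleftrightarrow> (\<forall>x\<in>dom A. inner (the (A x)) y = inner x z)" for z
  have unique: "z = z'" if "P z" "P z'" for z z'
  proof -
    have "z - z' = 0"
    proof (rule orthogonal_to_dense_eq_0)
      show "closure (dom A) = UNIV"
        using dense by (simp add: densely_defined_def)
      show "inner (z - z') v = 0" if "v \<in> dom A" for v
        using \<open>P z\<close> \<open>P z'\<close> that unfolding P_def by (metis diff_self inner_commute inner_diff_left)
    qed
    then show ?thesis
      by simp
  qed
  have "adjoint_op A y = (if \<exists>z. P z then Some (THE z. P z) else None)"
    unfolding adjoint_op_def * P_def ..
  then show ?thesis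
    unfolding P_def[symmetric] by (metis option.distinct(1) option.inject the_equality unique)
qed

lemma inverse_op_eq_Some_iff:
  assumes "injective_op A"
  shows "inverse_op A y = Some x \<longleftrightarrow> A x = Some y"
proof -
  have inj: "x = x'" if "A x = Some y" "A x' = Some y" for x x'
    using assms that unfolding injective_op_def by (metis domI inj_onD)
  show ?thesis
  proof (cases "y \<in> ran A")
    case True
    then obtain x' where x': "A x' = Some y"
      by (auto simp: ran_def)
    with inj have "(THE x. A x = Some y) = x'"
      by blast
    with True x' inj show ?thesis
      by (auto simp: inverse_op_def)
  next
    case False
    then show ?thesis
      by (auto simp: inverse_op_def ran_def)
  qed
qed

lemma conjugation_inner:
  assumes "conjugation J"
  shows "inner (J x) (J y) = inner x y" "inner (J x) y = inner x (J y)"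
  using assms unfolding conjugation_def
  by (metis Re_cinner inner_commute)+

lemma conjugation_bounded_linear:
  assumes J: "conjugation J"
  shows "bounded_linear J"
proof (rule bounded_linear_intro[where K = 1])
  show "J (x + y) = J x + J y" for x y
    using J by (simp add: conjugation_def)
  show "J (r *\<^sub>R x) = r *\<^sub>R J x" for r x
    using J by (metis complex_cnj_complex_of_real conjugation_def scaleC_of_real)
  show "norm (J x) \<le> norm x * 1" for x
    using conjugation_inner(1)[OF J] by (simp add: norm_eq_sqrt_inner)
qed

text \<open>In terms of graphs, \<open>A^-1 = J A^* J\<close> says that \<open>A x = y\<close>
  exactly when \<open>A^*\<close> maps \<open>J y\<close> to \<open>J x\<close>. Injectivity is
  absorbed, since this recovers \<open>x\<close> from \<open>A x\<close>.\<close>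

lemma J_unitary_iff:
  fixes J :: "'a :: complex_inner \<Rightarrow> 'a"
  assumes J: "conjugation J"
  shows "J_unitary J A \<longleftrightarrow> linear_op A \<and> densely_defined A \<and>
    (\<forall>x y. A x = Some y \<longleftrightarrow> (\<forall>v\<in>dom A. inner (the (A v)) (J y) = inner v (J x)))"
    (is "?L \<longleftrightarrow> ?R")
proof -
  have JJ: "J (J x) = x" for x
    using J by (simp add: conjugation_def)
  have adj: "((Some \<circ> J) \<circ>\<^sub>m adjoint_op A \<circ>\<^sub>m (Some \<circ> J)) y = Some x \<longleftrightarrow>
      (\<forall>v\<in>dom A. inner (the (A v)) (J y) = inner v (J x))"
    if "linear_op A" "densely_defined A" for x y
    unfolding adjoint_op_eq_Some_iff[OF that, symmetric]
    by (auto simp: map_comp_def split: option.splits) (metis JJ)+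
  show ?thesis
  proof
    assume ?L
    then show ?R
      unfolding J_unitary_def using adj inverse_op_eq_Some_iff by metis
  next
    assume R: ?R
    then have A: "linear_op A" "densely_defined A"
      and iff: "A x = Some y \<longleftrightarrow> (\<forall>v\<in>dom A. inner (the (A v)) (J y) = inner v (J x))" for x y
      by blast+
    have "injective_op A"
      unfolding injective_op_def
    proof (rule inj_onI)
      fix x x'
      assume "x \<in> dom A" "x' \<in> dom A" "A x = A x'"
      then have "A x = Some (the (A x))" "A x' = Some (the (A x))"
        by auto
      then have "adjoint_op A (J (the (A x))) = Some (J x)" "adjoint_op A (J (the (A x))) = Some (J x')"
        by (simp_all add: adjoint_op_eq_Some_iff[OF A] iff)
      then show "x = x'"
        by (metis JJ option.inject)
    qed
    moreover have "inverse_op A = (Some \<circ> J) \<circ>\<^sub>m adjoint_op A \<circ>\<^sub>m (Some \<circ> J)"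
    proof
      fix y
      have "inverse_op A y = Some x \<longleftrightarrow> ((Some \<circ> J) \<circ>\<^sub>m adjoint_op A \<circ>\<^sub>m (Some \<circ> J)) y = Some x" for x
        by (simp only: adj[OF A] inverse_op_eq_Some_iff[OF \<open>injective_op A\<close>] iff)
      then show "inverse_op A y = ((Some \<circ> J) \<circ>\<^sub>m adjoint_op A \<circ>\<^sub>m (Some \<circ> J)) y"
        by (metis option.exhaust)
    qed
    ultimately show ?L
      using A by (simp add: J_unitary_def)
  qed
qed

text \<open>As \<open>U\<close> commutes with \<open>J\<close> and preserves inner products, it
  cancels from the pairing of \<open>U (B v)\<close> with \<open>J (U w)\<close>; surjectivity
  writes every \<open>y\<close> as \<open>U w\<close>.\<close>

lemma unitary_comp_J_unitary:
  assumes J: "conjugation J" and U: "unitary_op U" "J_real J U" and B: "J_unitary J B"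
  shows "J_unitary J (U \<circ>\<^sub>m B)"
proof -
  define u where "u = the \<circ> U"
  have U_eq: "U x = Some (u x)" for x
    using U(1) by (metis UNIV_I comp_apply domD option.sel u_def unitary_op_def)
  have u_add: "u (x + y) = u x + u y" and u_scaleC: "u (c *\<^sub>C x) = c *\<^sub>C u x"
    and u_cinner: "cinner (u x) (u y) = cinner x y" and u_J: "u (J x) = J (u x)" for x y c
    using U by (auto simp: unitary_op_def linear_op_def J_real_def u_def)
  have u_inner: "inner (u x) (u y) = inner x y" for x y
    using u_cinner by (metis Re_cinner)
  have "surj u"
  proof (rule surjI[of _ "\<lambda>y. SOME x. u x = y"])
    fix y
    have "y \<in> ran U"
      using U(1) by (simp add: unitary_op_def)
    then have "\<exists>x. u x = y"
      by (auto simp: ran_def U_eq)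
    then show "u (SOME x. u x = y) = y"
      by (rule someI_ex)
  qed
  from B have lin: "linear_op B" and dense: "densely_defined B"
    and iff: "B x = Some y \<longleftrightarrow> (\<forall>v\<in>dom B. inner (the (B v)) (J y) = inner v (J x))" for x y
    unfolding J_unitary_iff[OF J] by blast+
  have comp: "(U \<circ>\<^sub>m B) x = map_option u (B x)" for x
    by (simp add: map_comp_def U_eq split: option.splits)
  have dom: "dom (U \<circ>\<^sub>m B) = dom B"
    by (auto simp: comp dom_def)
  have app: "the ((U \<circ>\<^sub>m B) x) = u (the (B x))" if "x \<in> dom B" for x
    using that by (auto simp: comp)
  have "(U \<circ>\<^sub>m B) x = Some y \<longleftrightarrow> (\<forall>v\<in>dom B. inner (the ((U \<circ>\<^sub>m B) v)) (J y) = inner v (J x))" for x y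
  proof -
    obtain w where w: "y = u w"
      using \<open>surj u\<close> by blast
    have "inj u"
      by (rule injI) (metis u_inner eq_iff_diff_eq_0 inner_commute inner_diff_right inner_eq_zero_iff)
    then have "(U \<circ>\<^sub>m B) x = Some y \<longleftrightarrow> B x = Some w"
      by (auto simp: comp w inj_eq)
    also have "\<dots> \<longleftrightarrow> (\<forall>v\<in>dom B. inner (the ((U \<circ>\<^sub>m B) v)) (J y) = inner v (J x))"
      by (simp add: iff app w u_J[symmetric] u_inner)
    finally show ?thesis .
  qed
  moreover have "linear_op (U \<circ>\<^sub>m B)"
    using lin unfolding linear_op_def dom by (simp add: app u_add u_scaleC)
  ultimately show ?thesis
    using dense unfolding J_unitary_iff[OF J] dom by (simp add: densely_defined_def dom)
qed

section \<open>The polar decomposition of a \<open>J\<close>-unitary operator\<close>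

text \<open>The partial operator is split into its domain \<open>D\<close> and a total function
  \<open>F\<close> constrained only on \<open>D\<close>; \<open>graph_iff\<close> is the condition
  of \<open>J_unitary_iff\<close>.\<close>

locale J_unitary_graph =
  fixes J :: "'a :: complex_hilbert \<Rightarrow> 'a" and D :: "'a set" and F :: "'a \<Rightarrow> 'a"
  assumes J: "conjugation J"
    and D_0: "0 \<in> D"
    and D_add: "x \<in> D \<Longrightarrow> y \<in> D \<Longrightarrow> x + y \<in> D"
    and F_add: "x \<in> D \<Longrightarrow> y \<in> D \<Longrightarrow> F (x + y) = F x + F y"
    and D_scaleC: "x \<in> D \<Longrightarrow> c *\<^sub>C x \<in> D"
    and F_scaleC: "x \<in> D \<Longrightarrow> F (c *\<^sub>C x) = c *\<^sub>C F x"
    and D_dense: "closure D = UNIV"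
    and graph_iff: "x \<in> D \<and> F x = y \<longleftrightarrow> (\<forall>v\<in>D. inner (F v) (J y) = inner v (J x))"
begin

lemma J_J [simp]: "J (J x) = x"
  using J by (simp add: conjugation_def)

lemma J_scaleC: "J (c *\<^sub>C x) = cnj c *\<^sub>C J x"
  using J by (simp add: conjugation_def)

lemmas J_inner [simp] = conjugation_inner(1)[OF J]
lemmas J_inner_left = conjugation_inner(2)[OF J]

sublocale J: bounded_linear J
  by (rule conjugation_bounded_linear[OF J])

lemma norm_J [simp]: "norm (J x) = norm x"
  by (simp add: norm_eq_sqrt_inner)

lemma D_scaleR: "x \<in> D \<Longrightarrow> r *\<^sub>R x \<in> D"
  and F_scaleR: "x \<in> D \<Longrightarrow> F (r *\<^sub>R x) = r *\<^sub>R F x"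
  using D_scaleC[of x "complex_of_real r"] F_scaleC[of x "complex_of_real r"]
  by (simp_all add: scaleC_of_real)

lemma F_0 [simp]: "F 0 = 0"
  using F_scaleR[of 0 0] D_0 by simp

lemma D_diff: "x \<in> D \<Longrightarrow> y \<in> D \<Longrightarrow> x - y \<in> D"
  and F_diff: "x \<in> D \<Longrightarrow> y \<in> D \<Longrightarrow> F (x - y) = F x - F y"
  using D_add[of x "- 1 *\<^sub>R y"] D_scaleR[of y "- 1"] F_add[of x "- 1 *\<^sub>R y"] F_scaleR[of y "- 1"]
  by simp_all

lemma graphI: "(\<And>v. v \<in> D \<Longrightarrow> inner (F v) (J y) = inner v (J x)) \<Longrightarrow> x \<in> D \<and> F x = y"
  using graph_iff by blast

lemma graphD: "x \<in> D \<Longrightarrow> v \<in> D \<Longrightarrow> inner (F v) (J (F x)) = inner v (J x)"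
  using graph_iff by blast

text \<open>By \<open>graph_iff\<close> the graph is cut out by equations that are continuous in
  both entries, just like the graph of an adjoint.\<close>

lemma graph_closed:
  assumes "\<And>n. x n \<in> D" "x \<longlonglongrightarrow> a" "(\<lambda>n. F (x n)) \<longlonglongrightarrow> b"
  shows "a \<in> D \<and> F a = b"
proof (rule graphI)
  fix v
  assume "v \<in> D"
  show "inner (F v) (J b) = inner v (J a)"
  proof (rule LIMSEQ_unique)
    show "(\<lambda>n. inner (F v) (J (F (x n)))) \<longlonglongrightarrow> inner (F v) (J b)"
      by (intro tendsto_intros J.tendsto assms)
    show "(\<lambda>n. inner (F v) (J (F (x n)))) \<longlonglongrightarrow> inner v (J a)"
      using graphD[OF assms(1) \<open>v \<in> D\<close>] by (simp, intro tendsto_intros J.tendsto assms)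
  qed
qed

section \<open>The resolvent of \<open>A^*A\<close>\<close>

definition S :: "'a \<Rightarrow> 'a" where
  "S x = (SOME u. u \<in> D \<and> (\<forall>v\<in>D. inner x v = inner u v + inner (F u) (F v)))"

text \<open>\<open>S\<close> is \<open>(I + A\<^sup>*A)\<^sup>-\<^sup>1\<close>: the vector \<open>S x\<close> is the first component of the projection
  of \<open>(x, 0)\<close> onto the graph of \<open>A\<close>.\<close>

lemma S_D [simp]: "S x \<in> D"
  and S_eq: "v \<in> D \<Longrightarrow> inner x v = inner (S x) v + inner (F (S x)) (F v)"
proof -
  define G where "G = (\<lambda>x. (x, F x)) ` D"
  have "subspace G"
    unfolding subspace_def G_def
    by (auto simp: image_iff zero_prod_def D_0 D_add F_add D_scaleR F_scaleR)
  moreover have "complete G"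
    unfolding complete_eq_closed closed_sequential_limits
  proof safe
    fix w a b
    assume w: "\<forall>n. w n \<in> G" "w \<longlonglongrightarrow> (a, b)"
    define x where "x n = fst (w n)" for n
    have "x n \<in> D" "w n = (x n, F (x n))" for n
      using w(1) by (auto simp: G_def x_def image_iff dest!: spec[of _ n])
    moreover from this w(2) have "x \<longlonglongrightarrow> a" "(\<lambda>n. F (x n)) \<longlonglongrightarrow> b"
      using tendsto_fst[OF w(2)] tendsto_snd[OF w(2)] by simp_all
    ultimately show "(a, b) \<in> G"
      using graph_closed[of x a b] by (auto simp: G_def)
  qed
  ultimately obtain p where p: "p \<in> G" "\<And>v. v \<in> G \<Longrightarrow> inner ((x, 0) - p) v = 0"
    using ex_orthogonal_projection[of G "(x, 0)"] by metis
  then obtain u where u: "u \<in> D" "p = (u, F u)"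
    by (auto simp: G_def)
  have "inner x v = inner u v + inner (F u) (F v)" if "v \<in> D" for v
    using p(2)[of "(v, F v)"] that by (simp add: G_def u inner_simps)
  with u have "\<exists>u. u \<in> D \<and> (\<forall>v\<in>D. inner x v = inner u v + inner (F u) (F v))"
    by blast
  then have "S x \<in> D \<and> (\<forall>v\<in>D. inner x v = inner (S x) v + inner (F (S x)) (F v))"
    unfolding S_def by (rule someI_ex)
  then show "S x \<in> D" "v \<in> D \<Longrightarrow> inner x v = inner (S x) v + inner (F (S x)) (F v)"
    by blast+
qed

text \<open>Two candidates differ by a vector orthogonal to itself in the graph inner product.
  Linearity of \<open>S\<close> and \<open>S_J\<close> reduce to this.\<close>

lemma S_unique:
  assumes "u \<in> D" "\<And>v. v \<in> D \<Longrightarrow> inner x v = inner u v + inner (F u) (F v)"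
  shows "S x = u"
proof -
  have d: "S x - u \<in> D"
    using assms by (simp add: D_diff)
  have "inner (S x - u) (S x - u) + inner (F (S x - u)) (F (S x - u)) = 0"
    using assms(2)[OF d] S_eq[OF d, of x] by (simp add: F_diff assms(1) inner_diff_left)
  then have "inner (S x - u) (S x - u) = 0"
    by (simp add: add_nonneg_eq_0_iff)
  then show ?thesis
    by simp
qed

lemma S_add: "S (x + y) = S x + S y"
  by (rule S_unique) (auto simp: D_add F_add inner_add_left S_eq[of _ x] S_eq[of _ y])

lemma S_scaleR: "S (r *\<^sub>R x) = r *\<^sub>R S x"
  by (rule S_unique) (auto simp: D_scaleR F_scaleR S_eq[of _ x] algebra_simps)

lemma S_scaleC_i: "S (\<i> *\<^sub>C x) = \<i> *\<^sub>C S x"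
proof (rule S_unique)
  fix v
  assume "v \<in> D"
  then show "inner (\<i> *\<^sub>C x) v = inner (\<i> *\<^sub>C S x) v + inner (F (\<i> *\<^sub>C S x)) (F v)"
    using S_eq[of "\<i> *\<^sub>C v" x] by (simp add: inner_scaleC_i_left D_scaleC F_scaleC)
qed (simp add: D_scaleC)

text \<open>\<open>S_eq\<close> says that \<open>A^*\<close> maps \<open>F (S x)\<close> to
  \<open>x - S x\<close>; the relation \<open>A^-1 = J A^* J\<close> turns this into a point of the
  graph of \<open>A\<close>.\<close>

lemma graph_J_S: "J (x - S x) \<in> D \<and> F (J (x - S x)) = J (F (S x))"
proof (rule graphI)
  fix v
  assume "v \<in> D"
  then show "inner (F v) (J (J (F (S x)))) = inner v (J (J (x - S x)))"
    using S_eq[of v x] by (simp add: inner_commute inner_diff_right)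
qed

text \<open>The resolvent form of \<open>J A\<^sup>*A J = (A\<^sup>*A)\<^sup>-\<^sup>1\<close>.\<close>

lemma S_J: "S (J x) = J (x - S x)"
proof (rule S_unique)
  show "J (x - S x) \<in> D"
    using graph_J_S by blast
  fix v
  assume "v \<in> D"
  then have "inner (F v) (J (F (S x))) = inner v (J (S x))"
    by (intro graphD) simp_all
  then show "inner (J x) v = inner (J (x - S x)) v + inner (F (J (x - S x))) (F v)"
    using graph_J_S[of x] by (simp add: J.diff inner_diff_left inner_commute[of "F v"] inner_commute[of v])
qed

lemma S_sym: "inner (S x) y = inner x (S y)"
  using S_eq[of "S y" x] S_eq[of "S x" y] by (simp add: inner_commute)

lemma norm_S_le: "norm (S x) \<le> norm x"
proof -
  have "(norm (S x))\<^sup>2 \<le> inner x (S x)"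
    using S_eq[of "S x" x] by (simp add: power2_norm_eq_inner)
  also have "\<dots> \<le> norm x * norm (S x)"
    by (rule norm_cauchy_schwarz)
  finally have "norm (S x) * norm (S x) \<le> norm x * norm (S x)"
    by (simp add: power2_eq_square)
  then show ?thesis
    by (cases "S x = 0") simp_all
qed

lemma bounded_linear_S: "bounded_linear S"
  by (rule bounded_linear_intro[where K = 1]) (simp_all add: S_add S_scaleR norm_S_le)

text \<open>\<open>S_J\<close> makes \<open>I - S\<close> the conjugate of \<open>S\<close> by
  \<open>J\<close>, so the bound on \<open>S\<close> carries over.\<close>

lemma S_contraction: "norm (x - S x) \<le> norm x"
  using norm_S_le[of "J x"] by (simp add: S_J)

lemma S_eq_0: "S x = 0 \<Longrightarrow> x = 0"
  using S_eq[of _ x] by (intro orthogonal_to_dense_eq_0[OF D_dense]) simp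

section \<open>Square roots of \<open>S\<close> and \<open>I - S\<close>\<close>

definition R :: "'a \<Rightarrow> 'a" where
  "R = (SOME R. bounded_linear R \<and> (\<forall>x y. inner (R x) y = inner x (R y)) \<and>
    (\<forall>x. norm (x - R x) \<le> norm x) \<and> (\<forall>x. R (R x) = S x) \<and>
    (\<forall>K. bounded_linear K \<longrightarrow> (\<forall>x. K (S x) = S (K x)) \<longrightarrow> (\<forall>x. K (R x) = R (K x))))"

definition C :: "'a \<Rightarrow> 'a" where
  "C x = J (R (J x))"

lemma bounded_linear_R: "bounded_linear R"
  and R_sym: "inner (R x) y = inner x (R y)"
  and R_contraction: "norm (x - R x) \<le> norm x"
  and R_R: "R (R x) = S x"
  and R_comm: "bounded_linear K \<Longrightarrow> (\<And>x. K (S x) = S (K x)) \<Longrightarrow> K (R x) = R (K x)"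
  using someI_ex[OF ex_sqrt_contraction[OF bounded_linear_S S_sym S_contraction], folded R_def]
  by blast+

sublocale R: bounded_linear R
  by (rule bounded_linear_R)

sublocale C: bounded_linear C
  unfolding C_def
  by (intro bounded_linear_compose[OF J.bounded_linear_axioms]
      bounded_linear_compose[OF R.bounded_linear_axioms] J.bounded_linear_axioms)

lemma J_R: "J (R x) = C (J x)"
  and J_C: "J (C x) = R (J x)"
  by (simp_all add: C_def)

lemma C_sym: "inner (C x) y = inner x (C y)"
  by (simp add: C_def J_inner_left R_sym)

lemma C_C: "C (C x) = x - S x"
  by (simp add: C_def R_R S_J)

lemma R_R_plus_C_C: "R (R x) + C (C x) = x"
  by (simp add: R_R C_C)

text \<open>Conjugating \<open>R S = S R\<close> by \<open>J\<close> shows that \<open>C\<close>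
  commutes with \<open>I - S\<close>, hence with \<open>S\<close>; and \<open>R\<close> commutes
  with every bounded operator that commutes with \<open>S\<close>.\<close>

lemma R_C: "R (C x) = C (R x)"
proof -
  have "C (S y) = S (C y)" for y
  proof -
    have "J (S y) = J y - S (J y)"
      by (simp add: S_J J.diff)
    then have "C (S y) = J (R (J y) - S (R (J y)))"
      by (simp add: C_def R.diff R_R[symmetric])
    then show ?thesis
      by (simp add: S_J C_def)
  qed
  then show ?thesis
    by (metis R_comm C.bounded_linear_axioms)
qed

lemma J_scaleC_i: "J (\<i> *\<^sub>C x) = - (\<i> *\<^sub>C J x)"
  using J_scaleC[of \<i> x] scaleC_scaleC[of "- 1" \<i> "J x"] scaleC_of_real[of "- 1" "\<i> *\<^sub>C J x"]
  by simp

lemma R_scaleC_i: "R (\<i> *\<^sub>C x) = \<i> *\<^sub>C R x"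
  using R_comm[OF bounded_linear_scaleC_i] by (simp add: S_scaleC_i)

lemma C_scaleC_i: "C (\<i> *\<^sub>C x) = \<i> *\<^sub>C C x"
  by (simp add: C_def J_scaleC_i R.neg J.neg R_scaleC_i)

text \<open>The contraction bound encodes positivity: by Cauchy-Schwarz,
  \<open>inner (x - R x) x\<close> is at most \<open>(norm x)^2\<close>.\<close>

lemma inner_R_nonneg: "inner (R x) x \<ge> 0"
proof -
  have "norm (x - R x) * norm x \<le> norm x * norm x"
    using R_contraction by (rule mult_right_mono) simp
  then show ?thesis
    using norm_cauchy_schwarz[of "x - R x" x]
    by (simp add: inner_diff_left power2_norm_eq_inner[symmetric] power2_eq_square)
qed

text \<open>Commuting positive operators have a positive product: a root \<open>Q\<close> of
  \<open>R\<close> is moved past \<open>C\<close>, which leaves \<open>C\<close> tested at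
  \<open>Q x\<close>.\<close>

lemma inner_C_R_nonneg: "inner (C x) (R x) \<ge> 0"
proof -
  obtain Q where Q_sym: "\<forall>x y. inner (Q x) y = inner x (Q y)" and Q_Q: "\<forall>x. Q (Q x) = R x"
    and Q_comm: "\<forall>K. bounded_linear K \<longrightarrow> (\<forall>x. K (R x) = R (K x)) \<longrightarrow> (\<forall>x. K (Q x) = Q (K x))"
    using ex_sqrt_contraction[OF bounded_linear_R R_sym R_contraction] by blast
  have "C (Q x) = Q (C x)"
    using Q_comm C.bounded_linear_axioms R_C by simp
  then have "inner (C x) (R x) = inner (C (Q x)) (Q x)"
    using Q_sym Q_Q by metis
  also have "\<dots> = inner (R (J (Q x))) (J (Q x))"
    by (simp add: C_def J_inner_left)
  finally show ?thesis
    by (simp add: inner_R_nonneg)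
qed

lemma R_eq_0: "R x = 0 \<Longrightarrow> x = 0"
  using S_eq_0[of x] R_R[of x] by (simp add: R.zero)

lemma C_eq_0: "C x = 0 \<Longrightarrow> x = 0"
  by (metis J.zero J_C J_J R_eq_0)

lemma inj_R: "inj R"
  using R_eq_0 R.linear_axioms by (simp add: linear_injective_0)

lemma range_R_dense: "closure (range R) = UNIV"
proof (rule closure_eq_UNIV_if_orthogonal_trivial)
  show "subspace (range R)"
    by (intro linear_subspace_image R.linear_axioms subspace_UNIV)
  show "x = 0" if "\<And>v. v \<in> range R \<Longrightarrow> inner x v = 0" for x
    \<comment> \<open>Pairing \<open>x\<close> with \<open>R (R x)\<close> gives the squared norm of
      \<open>R x\<close>.\<close>
    using that[of "R (R x)"] R_sym[of x "R x"] by (simp add: R_eq_0)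
qed

lemma range_C_dense: "closure (range C) = UNIV"
proof (rule closure_eq_UNIV_if_orthogonal_trivial)
  show "subspace (range C)"
    by (intro linear_subspace_image C.linear_axioms subspace_UNIV)
  show "x = 0" if "\<And>v. v \<in> range C \<Longrightarrow> inner x v = 0" for x
    using that[of "C (C x)"] C_sym[of x "C x"] by (simp add: C_eq_0)
qed

section \<open>The unitary factor\<close>

lemma norm_C_le: "norm (C x) \<le> norm x"
proof -
  have "inner (R x) (R x) + inner (C x) (C x) = inner (R (R x) + C (C x)) x"
    by (simp only: R_sym C_sym inner_add_left)
  then have "inner (C x) (C x) \<le> inner x x"
    using inner_ge_zero[of "R x"] by (simp only: R_R_plus_C_C)
  then show ?thesis
    by (simp add: norm_eq_sqrt_inner)
qed

text \<open>The case \<open>u = R p\<close> of \<open>norm_F_R\<close>, where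
  \<open>R u = S p\<close> is already known to lie in \<open>D\<close>. It comes from
  \<open>A^*A S = I - S\<close>.\<close>

lemma norm_F_S: "norm (F (S p)) = norm (C (R p))"
proof -
  have "inner (F (S p)) (F (S p)) = inner (p - S p) (S p)"
    using S_eq[of "S p" p] by (simp add: inner_diff_left)
  also have "\<dots> = inner (C (C p)) (R (R p))"
    by (simp add: C_C R_R)
  also have "\<dots> = inner (C (R p)) (C (R p))"
    by (simp only: C_sym R_C[symmetric] R_sym)
  finally show ?thesis
    by (simp add: norm_eq_sqrt_inner)
qed

text \<open>On the dense range of \<open>R\<close> this is \<open>norm_F_S\<close>. The same
  identity makes the images of approximants Cauchy, and closedness of the graph carries both claims
  to the limit.\<close>

lemma R_D: "R u \<in> D"
  and norm_F_R: "norm (F (R u)) = norm (C u)"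
proof -
  have "u \<in> closure (range R)"
    by (simp add: range_R_dense)
  then obtain w where w: "\<And>n. w n \<in> range R" "w \<longlonglongrightarrow> u"
    unfolding closure_sequential by blast
  define p where "p n = inv R (w n)" for n
  have p: "w n = R (p n)" for n
    using w(1) by (simp add: p_def f_inv_into_f)
  have F_diff': "norm (F (S (p m)) - F (S (p n))) \<le> norm (w m - w n)" for m n
  proof -
    have "F (S (p m)) - F (S (p n)) = F (S (p m - p n))"
      using bounded_linear_S by (simp add: F_diff bounded_linear.linear linear_diff)
    then show ?thesis
      using norm_C_le[of "R (p m - p n)"] by (simp add: norm_F_S p R.diff)
  qed
  have "Cauchy (\<lambda>n. F (S (p n)))"
  proof (rule CauchyI)
    fix e :: real
    assume "e > 0"
    then obtain M where "\<And>m n. m \<ge> M \<Longrightarrow> n \<ge> M \<Longrightarrow> norm (w m - w n) < e"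
      using CauchyD[OF LIMSEQ_imp_Cauchy[OF w(2)]] by blast
    then show "\<exists>M. \<forall>m\<ge>M. \<forall>n\<ge>M. norm (F (S (p m)) - F (S (p n))) < e"
      using F_diff' by (meson le_less_trans)
  qed
  then obtain y where y: "(\<lambda>n. F (S (p n))) \<longlonglongrightarrow> y"
    using Cauchy_convergent convergent_def by blast
  have "(\<lambda>n. S (p n)) \<longlonglongrightarrow> R u"
    using R.tendsto[OF w(2)] by (simp add: p R_R)
  with y have Ru: "R u \<in> D \<and> F (R u) = y"
    by (intro graph_closed[of "\<lambda>n. S (p n)"]) simp_all
  have "norm y = norm (C u)"
  proof (rule LIMSEQ_unique)
    show "(\<lambda>n. norm (F (S (p n)))) \<longlonglongrightarrow> norm y"
      by (intro tendsto_intros y)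
    show "(\<lambda>n. norm (F (S (p n)))) \<longlonglongrightarrow> norm (C u)"
      unfolding norm_F_S p[symmetric] by (intro tendsto_norm C.tendsto w)
  qed
  with Ru show "R u \<in> D" "norm (F (R u)) = norm (C u)"
    by auto
qed

text \<open>The bounded operator \<open>A (I + A^*A)^(-1/2)\<close>, everywhere defined by
  \<open>R_D\<close>.\<close>

definition G :: "'a \<Rightarrow> 'a" where
  "G x = F (R x)"

text \<open>Since \<open>C = J R J\<close> and \<open>U C = F R\<close>, a \<open>J\<close>-real \<open>U\<close> satisfies
  \<open>U = U C C + J U J R R = F R C + J F R C J\<close>, which needs no extension by continuity.\<close>

definition U :: "'a \<Rightarrow> 'a" where
  "U x = G (C x) + J (G (C (J x)))"

sublocale G: bounded_linear G
  by (rule bounded_linear_intro[where K = 1])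
    (simp_all add: G_def R.add R.scale F_add F_scaleR R_D norm_F_R norm_C_le)

sublocale U: bounded_linear U
  unfolding U_def
  by (intro bounded_linear_add bounded_linear_compose[OF G.bounded_linear_axioms]
      bounded_linear_compose[OF C.bounded_linear_axioms]
      bounded_linear_compose[OF J.bounded_linear_axioms] C.bounded_linear_axioms J.bounded_linear_axioms)

lemma G_scaleC_i: "G (\<i> *\<^sub>C x) = \<i> *\<^sub>C G x"
  by (simp add: G_def R_scaleC_i F_scaleC R_D)

lemma U_scaleC_i: "U (\<i> *\<^sub>C x) = \<i> *\<^sub>C U x"
  by (simp add: U_def J_scaleC_i G_scaleC_i C_scaleC_i C.neg G.neg J.neg scaleC_add_right)

lemma U_scaleC: "U (c *\<^sub>C x) = c *\<^sub>C U x"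
  by (simp add: scaleC_Re_Im[of c] U.add U.scale U_scaleC_i)

lemma U_J: "U (J x) = J (U x)"
  by (simp add: U_def J.add add.commute)

text \<open>In \<open>U (C x)\<close> the first summand is \<open>G (C (C x))\<close>. The second is
  moved through \<open>J\<close> by \<open>graph_J_S\<close> and becomes \<open>G (R (R x))\<close>,
  so \<open>R^2 + C^2 = I\<close> makes the sum \<open>G x\<close>.\<close>

lemma U_C: "U (C x) = F (R x)"
proof -
  have "J (G (C (J (C x)))) = J (F (S (C (J x))))"
    by (simp only: G_def J_C R_C[symmetric] R_R)
  also have "\<dots> = F (J (C (C (C (J x)))))"
    using graph_J_S[of "C (J x)"] by (simp only: C_C[symmetric])
  also have "\<dots> = G (R (R x))"
    by (simp only: G_def J_C J_J)
  finally have "U (C x) = G (R (R x) + C (C x))"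
    by (simp add: U_def G.add)
  then show ?thesis
    by (simp add: R_R_plus_C_C G_def)
qed

text \<open>On the dense range of \<open>C\<close> this is \<open>norm_F_R\<close> read through
  \<open>U_C\<close>; continuity extends it.\<close>

lemma norm_U: "norm (U x) = norm x"
proof -
  have "closure (range C) \<subseteq> {x. norm (U x) = norm x}"
    by (intro closure_minimal closed_Collect_eq continuous_intros U.continuous_on)
      (auto simp: U_C norm_F_R)
  then show ?thesis
    using range_C_dense by blast
qed

lemma U_inner: "inner (U x) (U y) = inner x y"
proof -
  have "(norm (U (x + y)))\<^sup>2 = (norm (x + y))\<^sup>2"
    by (simp add: norm_U)
  then show ?thesis
    unfolding U.add norm_add_sq by (simp add: norm_U)
qed

text \<open>The range of an isometry is complete, so projecting is possible before surjectivity is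
  known. The vector \<open>q\<close> serves as \<open>U^* z\<close>.\<close>

lemma ex_projection_range_U: "\<exists>q. \<forall>x. inner (z - U q) (U x) = 0"
proof -
  have "complete (range U)"
    by (rule complete_isometric_image[of 1])
      (auto simp: norm_U U.bounded_linear_axioms complete_UNIV)
  then show ?thesis
    using ex_orthogonal_projection[OF linear_subspace_image[OF U.linear_axioms subspace_UNIV], of z]
    by auto
qed

text \<open>This identifies the domain of \<open>A\<close> with that of its modulus.\<close>

lemma range_R: "range R = D"
proof
  show "range R \<subseteq> D"
    using R_D by blast
  show "D \<subseteq> range R"
  proof
    fix v
    assume v: "v \<in> D"
    obtain q where q: "\<And>x. inner (F v - U q) (U x) = 0"
      using ex_projection_range_U by blast
    \<comment> \<open>The preimage is found backwards: if \<open>v = R x\<close>, then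
      \<open>F v = U (C x)\<close>, so \<open>q = C x\<close> and \<open>R v + C q = x\<close> by
      \<open>R^2 + C^2 = I\<close>.\<close>
    have "inner (v - R (R v + C q)) y = 0" for y
    proof -
      have "inner v y = inner v (S y) + inner (F v) (U (C (R y)))"
        using S_eq[OF v, of y] by (simp add: U_C R_R inner_commute)
      also have "\<dots> = inner v (R (R y)) + inner q (C (R y))"
        using q[of "C (R y)"] by (simp add: R_R inner_diff_left U_inner)
      also have "\<dots> = inner (R (R v + C q)) y"
        by (simp only: R_sym C_sym inner_add_left)
      finally show ?thesis
        by (simp add: inner_diff_left)
    qed
    from this[of "v - R (R v + C q)"] have "v = R (R v + C q)"
      by simp
    then show "v \<in> range R"
      by blast
  qed
qed

text \<open>A vector \<open>e\<close> orthogonal to the range of \<open>U\<close> is orthogonal to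
  the range of \<open>A\<close>, because \<open>F (R x) = U (C x)\<close>. By \<open>graphI\<close>
  the graph then contains \<open>(0, J e)\<close>, so \<open>e = 0\<close>.\<close>

lemma surj_U: "surj U"
proof -
  have "z \<in> range U" for z
  proof -
    obtain q where q: "\<And>x. inner (z - U q) (U x) = 0"
      using ex_projection_range_U by blast
    have "0 \<in> D \<and> F 0 = J (z - U q)"
    proof (rule graphI)
      fix v
      assume "v \<in> D"
      then obtain x where "v = R x"
        using range_R by blast
      with q[of "C x"] show "inner (F v) (J (J (z - U q))) = inner v (J 0)"
        by (simp add: U_C inner_commute J.zero)
    qed
    then have "J (J (z - U q)) = J 0"
      by simp
    then have "z = U q"
      by (simp add: J.zero)
    then show ?thesis
      by blast
  qed
  then show ?thesis
    by blast
qed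

section \<open>The modulus \<open>B = C R^-1\<close>\<close>

definition B_op :: "'a operator" where
  "B_op y = (if y \<in> range R then Some (C (inv R y)) else None)"

lemma B_op_R: "B_op (R x) = Some (C x)"
  by (simp add: B_op_def inv_f_f[OF inj_R])

lemma dom_B_op: "dom B_op = range R"
  by (auto simp: B_op_def dom_def)

text \<open>The adjoint condition and the \<open>J\<close>-unitarity condition for
  \<open>B_op\<close> both turn into this implicit equation of its graph.\<close>

lemma B_op_eq_Some_iff: "B_op y = Some z \<longleftrightarrow> R z = C y"
proof
  assume B: "B_op y = Some z"
  then obtain x where "y = R x"
    using dom_B_op by blast
  with B show "R z = C y"
    by (auto simp: B_op_R R_C)
next
  assume eq: "R z = C y"
  \<comment> \<open>Solves \<open>y = R x\<close> and \<open>z = C x\<close> for \<open>x\<close>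
    through \<open>R^2 + C^2 = I\<close>.\<close>
  define x where "x = R y + C z"
  have "R x = y"
    using R_R_plus_C_C[of y] by (simp add: x_def R.add R_C eq)
  moreover have "C x = z"
    using R_R_plus_C_C[of z] by (simp add: x_def C.add R_C[symmetric] eq[symmetric])
  ultimately show "B_op y = Some z"
    using B_op_R by metis
qed

lemma linear_B_op: "linear_op B_op"
proof -
  have R_scaleC: "R (c *\<^sub>C x) = c *\<^sub>C R x" and C_scaleC: "C (c *\<^sub>C x) = c *\<^sub>C C x" for c x
    by (simp_all add: scaleC_Re_Im[of c] R.add R.scale R_scaleC_i C.add C.scale C_scaleC_i)
  have "0 \<in> range R"
    by (metis R.zero rangeI)
  then show ?thesis
    unfolding linear_op_def dom_B_op
    by (auto simp: B_op_R R.add[symmetric] C.add R_scaleC[symmetric] C_scaleC)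
qed

lemma dense_B_op: "densely_defined B_op"
  by (simp add: densely_defined_def dom_B_op range_R_dense)

text \<open>Tested on the vectors \<open>R x\<close>, the adjoint condition equates the pairing of
  \<open>C x\<close> with \<open>y\<close> and that of \<open>R x\<close> with \<open>z\<close>; by
  symmetry this is again \<open>R z = C y\<close>.\<close>

lemma self_adjoint_B_op: "self_adjoint_op B_op"
proof -
  have "adjoint_op B_op y = Some z \<longleftrightarrow> B_op y = Some z" for y z
  proof -
    have "adjoint_op B_op y = Some z \<longleftrightarrow> (\<forall>x. inner x (C y) = inner x (R z))"
      unfolding adjoint_op_eq_Some_iff[OF linear_B_op dense_B_op] dom_B_op
      by (simp add: B_op_R R_sym C_sym)
    also have "\<dots> \<longleftrightarrow> R z = C y"
      by (auto simp: vector_eq_ldot)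
    finally show ?thesis
      by (simp add: B_op_eq_Some_iff)
  qed
  then have "adjoint_op B_op = B_op"
    by (intro ext) (metis option.exhaust)
  then show ?thesis
    by (simp add: self_adjoint_op_def linear_B_op dense_B_op)
qed

text \<open>\<open>J\<close> interchanges \<open>R\<close> and \<open>C\<close>, so the pairing
  condition collapses to \<open>R y = C x\<close>.\<close>

lemma J_unitary_B_op: "J_unitary J B_op"
proof -
  have "B_op x = Some y \<longleftrightarrow> (\<forall>v\<in>dom B_op. inner (the (B_op v)) (J y) = inner v (J x))" for x y
  proof -
    have "(\<forall>v\<in>dom B_op. inner (the (B_op v)) (J y) = inner v (J x)) \<longleftrightarrow>
        (\<forall>v. inner v (J (R y)) = inner v (J (C x)))"
      by (simp add: dom_B_op B_op_R R_sym C_sym J_R J_C)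
    also have "\<dots> \<longleftrightarrow> R y = C x"
      unfolding vector_eq_ldot by (metis J_J)
    finally show ?thesis
      by (simp add: B_op_eq_Some_iff)
  qed
  then show ?thesis
    by (simp add: J_unitary_iff[OF J] linear_B_op dense_B_op)
qed

lemma nonneg_B_op: "nonneg_op B_op"
proof -
  have "cinner (C x) (R x) \<in> \<real>\<^sub>\<ge>\<^sub>0" for x
  proof -
    \<comment> \<open>This number is the imaginary part of \<open>cinner (C x) (R x)\<close>; it
      equals its own negative because \<open>R\<close> and \<open>C\<close> are symmetric, complex
      linear and commute.\<close>
    have "inner (C x) (R (\<i> *\<^sub>C x)) = inner (R x) (C (\<i> *\<^sub>C x))"
      by (metis R_sym C_sym R_C)
    also have "\<dots> = - inner (C x) (R (\<i> *\<^sub>C x))"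
      by (simp add: C_scaleC_i R_scaleC_i inner_commute[of "R x"] inner_scaleC_i_left)
    finally have "Im (cinner (C x) (R x)) = 0"
      by (simp add: Im_cinner R_scaleC_i)
    then show ?thesis
      using inner_C_R_nonneg[of x] by (simp add: complex_nonneg_Reals_iff Re_cinner)
  qed
  then show ?thesis
    unfolding nonneg_op_def dom_B_op by (auto simp: linear_B_op B_op_R)
qed

lemma unitary_U: "unitary_op (\<lambda>x. Some (U x))"
proof -
  have "cinner (U x) (U y) = cinner x y" for x y
    by (simp add: cinner_eq_iff_inner U_inner flip: U_scaleC_i)
  moreover have "ran (\<lambda>x. Some (U x)) = UNIV"
    using surjD[OF surj_U] by (auto simp: ran_def) metis
  ultimately show ?thesis
    by (simp add: unitary_op_def linear_op_def U.add U_scaleC dom_def)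
qed

lemma J_real_U: "J_real J (\<lambda>x. Some (U x))"
  by (simp add: J_real_def linear_op_def U.add U_scaleC U_J dom_def)

end

theorem theorem1:
  fixes J :: "'a :: complex_hilbert \<Rightarrow> 'a"
  assumes "conjugation J"
  shows "(\<forall>A. J_unitary J A \<longrightarrow>
            (\<exists>U B. unitary_op U \<and> J_real J U \<and>
                   nonneg_op B \<and> self_adjoint_op B \<and> J_unitary J B \<and>
                   A = U \<circ>\<^sub>m B)) \<and>
         (\<forall>A. linear_op A \<longrightarrow>
            (\<exists>U B. unitary_op U \<and> J_real J U \<and>
                   nonneg_op B \<and> self_adjoint_op B \<and> J_unitary J B \<and>
                   A = U \<circ>\<^sub>m B) \<longrightarrow>
            J_unitary J A)"
proof (intro conjI allI impI)
  fix A
  assume "J_unitary J A"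
  then have A: "linear_op A" "densely_defined A"
    and iff: "A x = Some y \<longleftrightarrow> (\<forall>v\<in>dom A. inner (the (A v)) (J y) = inner v (J x))" for x y
    unfolding J_unitary_iff[OF assms] by blast+
  interpret J_unitary_graph J "dom A" "\<lambda>x. the (A x)"
  proof
    show "x \<in> dom A \<and> the (A x) = y \<longleftrightarrow> (\<forall>v\<in>dom A. inner (the (A v)) (J y) = inner v (J x))" for x y
      unfolding iff[symmetric] by (metis domD domI option.sel)
  qed (use assms A in \<open>simp_all add: linear_op_def densely_defined_def\<close>)
  \<comment> \<open>\<open>U_C\<close> gives equal values on \<open>range R\<close>, and
    \<open>range_R\<close> makes the two domains agree.\<close>
  have "A = (\<lambda>x. Some (U x)) \<circ>\<^sub>m B_op"
  proof
    fix y
    show "A y = ((\<lambda>x. Some (U x)) \<circ>\<^sub>m B_op) y"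
    proof (cases "y \<in> range R")
      case True
      then obtain x where x: "y = R x"
        by blast
      with True have "A y = Some (U (C x))"
        by (metis U_C domD option.sel range_R)
      then show ?thesis
        by (simp add: x B_op_R)
    next
      case False
      then have "A y = None"
        unfolding range_R by (simp add: domIff)
      with False show ?thesis
        by (simp add: B_op_def)
    qed
  qed
  then show "\<exists>U B. unitary_op U \<and> J_real J U \<and>
      nonneg_op B \<and> self_adjoint_op B \<and> J_unitary J B \<and> A = U \<circ>\<^sub>m B"
    using unitary_U J_real_U nonneg_B_op self_adjoint_B_op J_unitary_B_op by blast
next
  fix A
  assume "\<exists>U B. unitary_op U \<and> J_real J U \<and>
      nonneg_op B \<and> self_adjoint_op B \<and> J_unitary J B \<and> A = U \<circ>\<^sub>m B"
  then show "J_unitary J A"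
    using unitary_comp_J_unitary[OF assms] by blast
qed

end
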